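(* Let $d>0$ and let $X$ be a metric space with a $d$-measure $m$ such that $C_X=2^d$. Then all doubling minimizers on $X$ and $m$ are absolutely continuous with respect to each other; that is, for every $\mu\in\mathrm{DM}(X)$ one has $\mu\ll m$ and $m\ll\mu$.
   Context: For a metric space $X$ with distance $\rho$, write $B(x,r)=\{y\in X: \rho(y,x)<r\}$. A Borel regular measure $\mu$ on $X$ is doubling if there is a constant $C>0$ with $\mu(B(x,2r))\le C\mu(B(x,r))$ for all $x\in X$, $r>0$, and $0<\mu(B(x_0,r_0))<\infty$ for some $x_0\in X$, $r_0>0$ (then $0<\mu(B(x,r))<\infty$ for all $x\in X$, $r>0$). Its doubling constant is $C_\mu=\sup_{x\in X,\,r>0}\mu(B(x,2r))/\mu(B(x,r))$. The least doubling constant of $X$ is $C_X=\inf_\mu C_\mu$, the infimum being over all doubling measures on $X$ ($C_X=\infty$ if there are none). The set of doubling minimizers is $\mathrm{DM}(X)=\{\mu \text{ doubling measure on } X: C_\mu=C_X\}$. A Borel measure $m$ on $X$ is called a $d$-measure ($d>0$) if there exist constants $C\ge 1$ and $r_0>0$ such that $\frac1C r^d\le m(B(x,r))\le C r^d$ for all $x\in X$ and all $0<r\le r_0$. *)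

theory Defs
  imports "HOL-Analysis.Analysis"
begin

text \<open>
  The metric space is the whole type. A Borel regular measure may live on a sigma-algebra larger than the
  Borel sets (for instance the Caratheodory measurable sets of a Borel regular outer measure), as long
  as every measurable set has a Borel superset of the same measure.
\<close>

definition borel_regular_measure :: "'a::topological_space measure \<Rightarrow> bool" where
  "borel_regular_measure M \<longleftrightarrow>
     sets borel \<subseteq> sets M \<and>
     (\<forall>A\<in>sets M. \<exists>B\<in>sets borel. A \<subseteq> B \<and> emeasure M B = emeasure M A)"

definition doubling_measure :: "'a::metric_space measure \<Rightarrow> bool" where
  "doubling_measure M \<longleftrightarrow>
     borel_regular_measure M \<and>
     (\<exists>C::real. C > 0 \<and>
        (\<forall>x r. r > 0 \<longrightarrow> emeasure M (ball x (2 * r)) \<le> ennreal C * emeasure M (ball x r))) \<and>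
     (\<exists>x0 r0. r0 > 0 \<and> 0 < emeasure M (ball x0 r0) \<and> emeasure M (ball x0 r0) < \<infinity>)"

definition doubling_constant :: "'a::metric_space measure \<Rightarrow> ennreal" where
  "doubling_constant M =
     (SUP (x, r) \<in> UNIV \<times> {0<..}. emeasure M (ball x (2 * r)) / emeasure M (ball x r))"

text \<open>The infimum over the empty set is \<open>\<infinity>\<close> in \<^typ>\<open>ennreal\<close>.\<close>

definition least_doubling_constant :: "'a::metric_space itself \<Rightarrow> ennreal" where
  "least_doubling_constant _ = (INF M \<in> {M :: 'a measure. doubling_measure M}. doubling_constant M)"

definition doubling_minimizers :: "'a::metric_space measure set" where
  "doubling_minimizers =
     {M. doubling_measure M \<and> doubling_constant M = least_doubling_constant TYPE('a)}"

definition d_measure :: "real \<Rightarrow> 'a::metric_space measure \<Rightarrow> bool" where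
  "d_measure d m \<longleftrightarrow>
     sets m = sets borel \<and>
     (\<exists>C r0::real. C \<ge> 1 \<and> r0 > 0 \<and>
        (\<forall>x r. 0 < r \<and> r \<le> r0 \<longrightarrow>
           ennreal (1 / C * r powr d) \<le> emeasure m (ball x r) \<and>
           emeasure m (ball x r) \<le> ennreal (C * r powr d)))"

text \<open>
  \<open>abs_cont N M\<close> is \<open>N \<lless> M\<close>; the library predicate \<^const>\<open>absolutely_continuous\<close> takes its arguments in
  the opposite order. Since \<open>N\<close> and \<open>M\<close> may have different sigma-algebras, null sets are understood as
  subsets of measurable null sets (sets of outer measure zero), i.e. null sets of the completion.
\<close>

definition abs_cont :: "'a measure \<Rightarrow> 'a measure \<Rightarrow> bool" where
  "abs_cont N M \<longleftrightarrow> absolutely_continuous (completion M) (completion N)"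

lemma abs_cont_iff_same_sets:
  assumes "sets M = sets N"
  shows "abs_cont N M \<longleftrightarrow> absolutely_continuous M N"
proof
  assume ac: "abs_cont N M"
  show "absolutely_continuous M N"
    unfolding absolutely_continuous_def
  proof
    fix A assume A: "A \<in> null_sets M"
    have "A \<in> null_sets (completion M)"
      unfolding null_sets_completion_iff2 using A by (rule bexI[rotated]) simp
    with ac have "A \<in> null_sets (completion N)"
      unfolding abs_cont_def absolutely_continuous_def by (rule subsetD)
    moreover have "A \<in> sets N"
      using null_setsD2[OF A] assms by simp
    ultimately show "A \<in> null_sets N"
      by (simp add: null_sets_completion_iff)
  qed
next
  assume ac: "absolutely_continuous M N"
  show "abs_cont N M"
    unfolding abs_cont_def absolutely_continuous_def
  proof
    fix A assume "A \<in> null_sets (completion M)"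
    then obtain B where "B \<in> null_sets M" "A \<subseteq> B"
      unfolding null_sets_completion_iff2 by (rule bexE)
    with ac show "A \<in> null_sets (completion N)"
      unfolding null_sets_completion_iff2 absolutely_continuous_def by (meson subsetD)
  qed
qed

end

theory Submission
  imports Defs
begin

text \<open>
  A doubling minimizer \<open>\<mu>\<close> has doubling constant \<open>2\<^sup>d\<close>, so \<open>\<mu>(B(x,2r)) \<le> 2\<^sup>d \<mu>(B(x,r))\<close> for all balls. The
  factor is the one by which \<open>r\<^sup>d\<close> grows, and therefore the densities
  \<open>f\<^sub>k(x) = \<mu>(B(x,r\<^sub>k)) / r\<^sub>k\<^sup>d\<close> at the dyadic scales \<open>r\<^sub>k = \<rho> / 2\<^sup>k\<close> increase with \<open>k\<close>, at every point.
  On the other hand, Fubini's theorem gives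
  \<open>\<integral>\<^sub>U f\<^sub>k dm = r\<^sub>k\<^sup>-\<^sup>d \<integral> m(B(y,r\<^sub>k) \<inter> U) d\<mu>(y)\<close>, and \<open>m(B(y,r\<^sub>k))\<close> is comparable to \<open>r\<^sub>k\<^sup>d\<close>. Hence,
  up to the constant \<open>C\<close> of \<open>m\<close>, the integral of \<open>f\<^sub>k\<close> over \<open>U\<close> lies between the \<open>\<mu>\<close>-measure of the points
  whose \<open>r\<^sub>k\<close>-ball stays inside \<open>U\<close> and that of the \<open>r\<^sub>k\<close>-neighbourhood of \<open>U\<close>
  (\<open>emeasure_le_integral_density_at\<close>, \<open>integral_density_at_le\<close>).

  For \<open>\<mu> \<lless> m\<close>, let \<open>g\<close> be the increasing limit of the \<open>f\<^sub>k\<close>. Monotone convergence turns the upper bound into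
  local \<open>m\<close>-integrability of \<open>g\<close>, and the lower bound into \<open>\<mu>(U) \<le> C \<integral>\<^sub>U g dm\<close> for open \<open>U\<close>. An
  \<open>m\<close>-null set is null for the locally finite measure \<open>g m\<close>, so open supersets on which the right-hand side is
  small exist by outer regularity, and the set is \<open>\<mu>\<close>-null.

  For \<open>m \<lless> \<mu>\<close>, monotonicity bounds all \<open>f\<^sub>k\<close> below by \<open>f\<^sub>0\<close>, which is bounded away from \<open>0\<close> on bounded sets.
  Integrating over a bounded closed set \<open>K\<close> gives \<open>c m(K) \<le> C \<mu>(N\<^sub>k)\<close> for the \<open>r\<^sub>k\<close>-neighbourhoods \<open>N\<^sub>k\<close> of
  \<open>K\<close>, which shrink to \<open>K\<close>; inner regularity of \<open>m\<close> passes from closed sets to Borel sets.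

  Fubini's theorem requires \<open>{(x,y). dist x y < r}\<close> to be measurable for the product \<open>\<sigma>\<close>-algebra and both
  measures to be \<open>\<sigma>\<close>-finite. Both follow from separability of the space, which holds because \<open>\<mu>\<close> gives
  every ball positive finite measure.
\<close>

section \<open>Neighbourhoods of sets\<close>

definition thickening :: "'a::metric_space set \<Rightarrow> real \<Rightarrow> 'a set" where
  "thickening A r = (\<Union>x\<in>A. ball x r)"

lemma open_thickening [simp]: "open (thickening A r)"
  by (auto simp: thickening_def)

lemma thickening_sets [measurable]: "thickening A r \<in> sets borel"
  by simp

lemma not_in_thickening_Compl_iff: "y \<notin> thickening (- U) r \<longleftrightarrow> ball y r \<subseteq> U"
  by (auto simp: thickening_def dist_commute subset_eq)

lemma thickening_mono: "r \<le> s \<Longrightarrow> thickening A r \<subseteq> thickening A s"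
  by (force simp: thickening_def)

lemma thickening_mono_set: "A \<subseteq> B \<Longrightarrow> thickening A r \<subseteq> thickening B r"
  by (auto simp: thickening_def)

lemma thickening_ball_subset:
  assumes "s + r \<le> t" shows "thickening (ball z s) r \<subseteq> ball z t"
proof
  fix y assume "y \<in> thickening (ball z s) r"
  then obtain x where "dist z x < s" "dist x y < r" by (auto simp: thickening_def)
  with assms dist_triangle[of z y x] show "y \<in> ball z t" by simp
qed

lemma Inter_thickening_closed:
  assumes "closed K" "r \<longlonglongrightarrow> 0" "\<And>k. r k > 0"
  shows "(\<Inter>k. thickening K (r k)) = K"
proof (intro equalityI subsetI)
  fix y assume y: "y \<in> (\<Inter>k. thickening K (r k))"
  show "y \<in> K"
  proof (rule ccontr)
    assume "y \<notin> K"
    with \<open>closed K\<close> obtain e where e: "e > 0" "ball y e \<subseteq> - K"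
      using open_contains_ball[of "- K"] by auto
    have "\<forall>\<^sub>F k in sequentially. r k < e"
      using order_tendstoD(2)[OF assms(2)] e(1) by blast
    then obtain k where "r k < e" by (auto simp: eventually_sequentially)
    moreover obtain x where "x \<in> K" "dist x y < r k" using y by (auto simp: thickening_def)
    ultimately have "x \<in> ball y e" by (simp add: dist_commute)
    with e(2) \<open>x \<in> K\<close> show False by auto
  qed
next
  fix y assume "y \<in> K"
  then show "y \<in> (\<Inter>k. thickening K (r k))"
    using assms(3) by (force simp: thickening_def)
qed

section \<open>Regularity of finite Borel measures on metric spaces\<close>

text \<open>
  The sets that can be squeezed, up to arbitrarily small measure, between a closed and an open set form a
  \<open>\<sigma>\<close>-algebra; it contains the open sets because an open set is the increasing union of the closed sets of
  points at distance at least \<open>1/k\<close> from its complement.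
\<close>

lemma finite_borel_measure_regular:
  fixes M :: "'a::metric_space measure"
  assumes "finite_measure M" and sets_M: "sets M = sets borel"
    and "A \<in> sets borel" and "e > 0"
  shows "\<exists>F U. closed F \<and> open U \<and> F \<subseteq> A \<and> A \<subseteq> U \<and> measure M (U - F) < e"
proof -
  interpret finite_measure M by fact
  note [measurable_cong] = sets_M
  have op: "S \<in> sets M" if "open S" for S using that sets_M by auto
  have cl: "S \<in> sets M" if "closed S" for S using that sets_M by auto
  have "A \<in> sigma_sets UNIV {S. open S}"
    using \<open>A \<in> sets borel\<close> by (simp add: borel_def)
  then show ?thesis
    using \<open>e > 0\<close>
  proof (induction arbitrary: e rule: sigma_sets.induct)
    case (Basic U)
    then have "open U" by simp
    let ?N = "\<lambda>k. thickening (- U) (inverse (real (Suc k)))"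
    have "(\<lambda>k. measure M (?N k)) \<longlonglongrightarrow> measure M (\<Inter>k. ?N k)"
    proof (rule finite_Lim_measure_decseq)
      show "decseq ?N"
        by (intro decseq_SucI thickening_mono) (simp add: field_simps)
    qed (auto simp: op)
    also have "(\<Inter>k. ?N k) = - U"
      using \<open>open U\<close> LIMSEQ_inverse_real_of_nat by (intro Inter_thickening_closed) auto
    finally have lim: "(\<lambda>k. measure M (?N k)) \<longlonglongrightarrow> measure M (- U)" .
    have "\<forall>\<^sub>F k in sequentially. measure M (?N k) < measure M (- U) + e"
      using order_tendstoD(2)[OF lim] Basic.prems by simp
    then obtain k where k: "measure M (?N k) < measure M (- U) + e"
      by (auto simp: eventually_sequentially)
    have sub: "- U \<subseteq> ?N k" by (force simp: thickening_def)
    have "U - - ?N k = ?N k - - U" by auto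
    then have "measure M (U - - ?N k) = measure M (?N k) - measure M (- U)"
      using finite_measure_Diff[OF _ _ sub] \<open>open U\<close> op[of "?N k"] cl[of "- U"] by auto
    with k sub \<open>open U\<close> show ?case
      by (intro exI[of _ "- ?N k"] exI[of _ U]) auto
  next
    case Empty
    then show ?case by (intro exI[of _ "{}"]) auto
  next
    case (Compl A)
    from Compl.IH[OF Compl.prems] obtain F U where
      "closed F" "open U" "F \<subseteq> A" "A \<subseteq> U" "measure M (U - F) < e" by blast
    moreover have "- F - - U = U - F" by auto
    ultimately show ?case
      by (intro exI[of _ "- U"] exI[of _ "- F"]) auto
  next
    case (Union A)
    have "\<forall>n. \<exists>F U. closed F \<and> open U \<and> F \<subseteq> A n \<and> A n \<subseteq> U \<and> measure M (U - F) < (e/2) * (1/2)^Suc n"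
      using Union.prems by (intro allI Union.IH) simp
    then obtain F U where F: "\<And>n. closed (F n)" "\<And>n. F n \<subseteq> A n"
      and U: "\<And>n. open (U n)" "\<And>n. A n \<subseteq> U n"
      and d: "\<And>n. measure M (U n - F n) < (e/2) * (1/2)^Suc n"
      by metis
    have sFU: "F n \<in> sets M" "U n \<in> sets M" for n using F(1) U(1) op cl by auto
    \<comment> \<open>Only a finite union of the closed sets is closed, so half of \<open>e\<close> is spent on the countable union
      and the other half on truncating it.\<close>
    let ?U = "\<Union>n. U n"
    let ?G = "\<lambda>N. \<Union>n<N. F n"
    have geo: "(\<lambda>n. (e/2) * (1/2)^Suc n) sums (e/2)"
      using sums_mult[OF power_half_series, of "e/2"] by simp
    have sm: "summable (\<lambda>n. measure M (U n - F n))"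
      by (rule summable_comparison_test'[OF sums_summable[OF geo], of 0])
        (use d in \<open>simp add: less_imp_le del: power_Suc\<close>)
    have "measure M (?U - (\<Union>n. F n)) \<le> measure M (\<Union>n. U n - F n)"
      using sFU by (intro finite_measure_mono) auto
    also have "\<dots> \<le> (\<Sum>n. measure M (U n - F n))"
      using sFU sm by (intro finite_measure_subadditive_countably) auto
    also have "\<dots> \<le> e/2"
      by (rule sums_le[OF less_imp_le[OF d] summable_sums[OF sm] geo])
    finally have half: "measure M (?U - (\<Union>n. F n)) \<le> e/2" .
    have "(\<lambda>N. measure M (?U - ?G N)) \<longlonglongrightarrow> measure M (\<Inter>N. ?U - ?G N)"
    proof (rule finite_Lim_measure_decseq)
      show "decseq (\<lambda>N. ?U - ?G N)" by (intro decseq_SucI) auto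
    qed (use sFU in auto)
    also have "(\<Inter>N. ?U - ?G N) = ?U - (\<Union>n. F n)" by auto
    finally have lim: "(\<lambda>N. measure M (?U - ?G N)) \<longlonglongrightarrow> measure M (?U - (\<Union>n. F n))" .
    have "\<forall>\<^sub>F N in sequentially. measure M (?U - ?G N) < e"
      using order_tendstoD(2)[OF lim, of e] half Union.prems by simp
    then obtain N where N: "measure M (?U - ?G N) < e" by (auto simp: eventually_sequentially)
    show ?case
    proof (intro exI conjI)
      show "closed (?G N)" using F by (intro closed_UN) auto
      show "open ?U" using U by (intro open_UN) auto
      show "measure M (?U - ?G N) < e" by (rule N)
    qed (use F(2) U(2) in blast)+
  qed
qed

section \<open>Separability from a measure\<close>

text \<open>
  For a maximal \<open>e\<close>-separated set, the balls of radius \<open>e/2\<close> about its points in a given ball \<open>B\<close> are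
  disjoint, have positive measure, and lie in a single ball of finite measure. A convergent sum of
  positive terms has countably many of them, so the separated set is countable, and by maximality it
  is an \<open>e\<close>-net.
\<close>

lemma separable_if_balls_pos_finite:
  fixes M :: "'a::metric_space measure"
  assumes sets_M: "sets M = sets borel"
    and pos: "\<And>x r. r > 0 \<Longrightarrow> emeasure M (ball x r) > 0"
    and fin: "\<And>x r. emeasure M (ball x r) < \<infinity>"
  obtains D :: "'a set" where "countable D" "\<And>x e. e > 0 \<Longrightarrow> \<exists>z\<in>D. dist z x < e"
proof -
  define sep where "sep e S \<longleftrightarrow> (\<forall>x\<in>S. \<forall>y\<in>S. x \<noteq> y \<longrightarrow> dist x y \<ge> e)" for e and S :: "'a set"
  have net: "\<exists>S :: 'a set. countable S \<and> (\<forall>x. \<exists>z\<in>S. dist z x < e)" if "e > 0" for e :: real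
  proof -
    have "\<exists>S\<in>{S. sep e S}. \<forall>T\<in>{S. sep e S}. S \<subseteq> T \<longrightarrow> T = S"
    proof (rule subset_Zorn')
      fix c assume c: "subset.chain {S. sep e S} c"
      have "dist x y \<ge> e" if "X \<in> c" "Y \<in> c" "x \<in> X" "y \<in> Y" "x \<noteq> y" for X Y x y
      proof -
        have "sep e X" "sep e Y" "X \<subseteq> Y \<or> Y \<subseteq> X"
          using c that(1,2) unfolding subset.chain_def by auto
        with that(3-5) show ?thesis unfolding sep_def by blast
      qed
      then show "\<Union>c \<in> {S. sep e S}" unfolding sep_def by auto
    qed
    then obtain S where S: "sep e S" and mx: "\<And>T. sep e T \<Longrightarrow> S \<subseteq> T \<Longrightarrow> T = S" by blast
    have dense: "\<exists>z\<in>S. dist z x < e" for x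
    proof (rule ccontr)
      assume *: "\<not> ?thesis"
      then have "sep e (insert x S)" using S by (auto simp: sep_def dist_commute not_less)
      from mx[OF this] have "x \<in> S" by blast
      with * \<open>e > 0\<close> show False by force
    qed
    define x0 :: 'a where "x0 = undefined"
    define P where "P n = S \<inter> ball x0 (real n)" for n
    define w where "w x = measure M (ball x (e/2))" for x
    have wpos: "w x > 0" for x
      using pos[of "e/2" x] fin[of x "e/2"] \<open>e > 0\<close>
      by (simp add: w_def measure_def enn2real_positive_iff)
    have "countable (P n)" for n
    proof -
      let ?B = "ball x0 (real n + e)"
      have "w summable_on P n"
      proof (rule nonneg_bdd_above_summable_on)
        show "bdd_above (sum w ` {F. F \<subseteq> P n \<and> finite F})"
        proof (rule bdd_aboveI2[where M = "measure M ?B"])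
          fix F assume "F \<in> {F. F \<subseteq> P n \<and> finite F}"
          then have F: "F \<subseteq> P n" "finite F" by auto
          have "disjoint_family_on (\<lambda>x. ball x (e/2)) F"
          proof (unfold disjoint_family_on_def, intro ballI impI)
            fix x y assume "x \<in> F" "y \<in> F" "x \<noteq> y"
            then have "dist x y \<ge> e" using S F unfolding sep_def P_def by blast
            then show "ball x (e/2) \<inter> ball y (e/2) = {}"
              by (intro disjoint_ballI) auto
          qed
          then have "sum w F = measure M (\<Union>x\<in>F. ball x (e/2))"
            unfolding w_def using F(2) less_imp_neq[OF fin]
            by (intro measure_finite_Union[symmetric]) (simp_all add: image_subset_iff sets_M)
          also have "\<dots> \<le> measure M ?B"
          proof (rule measure_mono_fmeasurable)
            show "(\<Union>x\<in>F. ball x (e/2)) \<subseteq> ?B"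
            proof (intro UN_least subsetI)
              fix x y assume "x \<in> F" "y \<in> ball x (e/2)"
              then have "dist x0 x < n" "dist x y < e/2" using F by (auto simp: P_def)
              with dist_triangle[of x0 y x] \<open>e > 0\<close> show "y \<in> ?B" by auto
            qed
            show "(\<Union>x\<in>F. ball x (e/2)) \<in> sets M"
              unfolding sets_M by (intro borel_open open_UN) auto
            show "?B \<in> fmeasurable M"
              using fin by (intro fmeasurableI) (simp_all add: sets_M)
          qed
          finally show "sum w F \<le> measure M ?B" .
        qed
      qed (simp add: w_def)
      then have "countable {x \<in> P n. w x \<noteq> 0}" by (rule summable_countable_real)
      moreover have "{x \<in> P n. w x \<noteq> 0} = P n"
        using less_imp_neq[OF wpos] by (metis (mono_tags, lifting) Collect_cong Collect_mem_eq)
      ultimately show ?thesis by simp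
    qed
    moreover have "S = (\<Union>n. P n)"
    proof -
      have "\<exists>n. dist x0 x < real n" for x by (rule reals_Archimedean2)
      then show ?thesis unfolding P_def by auto
    qed
    ultimately have "countable S" using countable_UN[of UNIV P] by simp
    with dense show ?thesis by blast
  qed
  have "\<forall>n. \<exists>S :: 'a set. countable S \<and> (\<forall>x. \<exists>z\<in>S. dist z x < inverse (real (Suc n)))"
    by (intro allI net) simp
  from choice[OF this] obtain S :: "nat \<Rightarrow> 'a set" where S: "\<And>n. countable (S n)"
    "\<And>n x. \<exists>z\<in>S n. dist z x < inverse (real (Suc n))"
    by blast
  show thesis
  proof
    show "countable (\<Union>n. S n)" using S(1) by simp
    show "\<exists>z\<in>\<Union>n. S n. dist z x < e" if "e > 0" for x e
    proof -
      obtain n where "inverse (real (Suc n)) < e" using reals_Archimedean \<open>e > 0\<close> by blast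
      moreover obtain z where "z \<in> S n" "dist z x < inverse (real (Suc n))" using S(2) by blast
      ultimately have "z \<in> (\<Union>n. S n)" "dist z x < e" by auto
      then show ?thesis by blast
    qed
  qed
qed

lemma sigma_finite_if_balls_finite:
  fixes M :: "'a::metric_space measure" and D :: "'a set"
  assumes "sets M = sets borel" "countable D" "\<And>x. \<exists>z\<in>D. dist z x < r"
    and "\<And>x. emeasure M (ball x r) < \<infinity>"
  shows "sigma_finite_measure M"
proof
  have "space M = UNIV" using sets_eq_imp_space_eq[OF assms(1)] by simp
  moreover have "(\<Union>z\<in>D. ball z r) = UNIV" using assms(3) by auto
  ultimately have "countable ((\<lambda>z. ball z r) ` D)" "(\<lambda>z. ball z r) ` D \<subseteq> sets M"
    "\<Union>((\<lambda>z. ball z r) ` D) = space M" "\<forall>a\<in>(\<lambda>z. ball z r) ` D. emeasure M a \<noteq> \<infinity>"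
    using assms(1,2,4) by (auto simp: less_top)
  then show "\<exists>A. countable A \<and> A \<subseteq> sets M \<and> \<Union> A = space M \<and> (\<forall>a\<in>A. emeasure M a \<noteq> \<infinity>)"
    by blast
qed

section \<open>Densities at dyadic scales\<close>

text \<open>
  The growth exponent \<open>d\<close> of \<open>m\<close> equals the base-2 logarithm of the doubling constant allowed for \<open>\<mu>\<close>; this
  coincidence makes the densities of \<open>\<mu>\<close> monotone in the scale. Both measures live on the Borel sets here.
\<close>

locale critical_pair =
  fixes d C \<rho> :: real and m \<mu> :: "'a::metric_space measure"
  assumes C_pos: "C > 0" and rho_pos: "\<rho> > 0"
    and sets_m [measurable_cong]: "sets m = sets borel"
    and sets_mu [measurable_cong]: "sets \<mu> = sets borel"
    and m_lower: "0 < r \<Longrightarrow> r \<le> \<rho> \<Longrightarrow> ennreal (1 / C * r powr d) \<le> emeasure m (ball x r)"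
    and m_upper: "0 < r \<Longrightarrow> r \<le> \<rho> \<Longrightarrow> emeasure m (ball x r) \<le> ennreal (C * r powr d)"
    and mu_pos: "0 < r \<Longrightarrow> 0 < emeasure \<mu> (ball x r)"
    and mu_finite: "emeasure \<mu> (ball x r) < \<infinity>"
    and mu_doubling: "0 < r \<Longrightarrow> emeasure \<mu> (ball x (2 * r)) \<le> ennreal (2 powr d) * emeasure \<mu> (ball x r)"
begin

lemma m_finite: "emeasure m (ball x \<rho>) < \<infinity>"
  using le_less_trans[OF m_upper[OF rho_pos order_refl]] by simp

lemma space_m [simp]: "space m = UNIV" and space_mu [simp]: "space \<mu> = UNIV"
  using sets_eq_imp_space_eq[OF sets_m] sets_eq_imp_space_eq[OF sets_mu] by auto

lemma ball_sets [measurable]: "ball x r \<in> sets borel"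
  by simp

definition dense_set :: "'a set" where
  "dense_set = (SOME D. countable D \<and> (\<forall>x. \<forall>e>0. \<exists>z\<in>D. dist z x < e))"

lemma countable_dense_set: "countable dense_set"
  and dense_set: "e > 0 \<Longrightarrow> \<exists>z\<in>dense_set. dist z x < e"
proof -
  have "\<exists>D::'a set. countable D \<and> (\<forall>x. \<forall>e>0. \<exists>z\<in>D. dist z x < e)"
    by (rule separable_if_balls_pos_finite[OF sets_mu mu_pos mu_finite]) blast+
  from someI_ex[OF this, folded dense_set_def]
  show "countable dense_set" "e > 0 \<Longrightarrow> \<exists>z\<in>dense_set. dist z x < e" by blast+
qed

lemma dense_set_rho: "\<exists>z\<in>dense_set. dist z x < \<rho>"
  by (rule dense_set[OF rho_pos])

sublocale m: sigma_finite_measure m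
  by (rule sigma_finite_if_balls_finite[OF sets_m countable_dense_set dense_set_rho m_finite])

sublocale mu: sigma_finite_measure \<mu>
  by (rule sigma_finite_if_balls_finite[OF sets_mu countable_dense_set dense_set_rho mu_finite])

sublocale pair_sigma_finite m \<mu> ..

text \<open>
  If \<open>dist x y < r\<close>, a point \<open>z\<close> of the dense set close to \<open>x\<close> and a rational \<open>q\<close> slightly above
  \<open>dist z x\<close> place \<open>(x, y)\<close> in the rectangle \<open>B(z,q) \<times> B(z,r-q)\<close>, so the set is a countable union of
  rectangles.
\<close>

lemma near_pairs_measurable: "{p. dist (fst p) (snd p) < r} \<in> sets (m \<Otimes>\<^sub>M \<mu>)"
proof -
  have "{p. dist (fst p) (snd p) < r} =
    (\<Union>z\<in>dense_set. \<Union>q\<in>\<rat>. ball z q \<times> ball z (r - q))" (is "?L = ?R")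
  proof (intro equalityI subsetI)
    fix p assume "p \<in> ?L"
    then obtain x y where p: "p = (x, y)" and xy: "dist x y < r" by (cases p) auto
    define e where "e = (r - dist x y) / 2"
    have "e > 0" using xy by (simp add: e_def)
    then obtain z where z: "z \<in> dense_set" "dist z x < e" using dense_set by blast
    obtain q where q: "q \<in> \<rat>" "dist z x < q" "q < e" using Rats_dense_in_real[OF z(2)] by blast
    have "dist z y \<le> dist z x + dist x y" by (rule dist_triangle)
    then have "dist z y < r - q" using z q by (simp add: e_def)
    with q z show "p \<in> ?R" by (auto simp: p)
  next
    fix p assume "p \<in> ?R"
    then obtain z q where "dist z (fst p) < q" "dist z (snd p) < r - q" by auto
    with dist_triangle3[of "fst p" "snd p" z] show "p \<in> ?L" by simp
  qed
  also have "\<dots> \<in> sets (m \<Otimes>\<^sub>M \<mu>)"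
    by (intro sets.countable_UN'' countable_dense_set countable_rat pair_measureI)
      (simp_all add: sets_m sets_mu)
  finally show ?thesis .
qed

lemma emeasure_ball_measurable [measurable]: "(\<lambda>x. emeasure \<mu> (ball x r)) \<in> borel_measurable borel"
proof -
  have "(\<lambda>x. emeasure \<mu> (Pair x -` {p. dist (fst p) (snd p) < r})) \<in> borel_measurable m"
    by (rule mu.measurable_emeasure_Pair[OF near_pairs_measurable])
  also have "(\<lambda>x. Pair x -` {p. dist (fst p) (snd p) < r}) = (\<lambda>x. ball x r)"
    by auto
  finally show ?thesis using measurable_cong_sets[OF sets_m refl] by blast
qed

text \<open>
  Both sides integrate the indicator of \<open>{(x,y). x \<in> U \<and> dist x y < r}\<close> over the product measure.
\<close>

lemma integral_emeasure_ball:
  assumes [measurable]: "U \<in> sets borel"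
  shows "(\<integral>\<^sup>+x. indicator U x * emeasure \<mu> (ball x r) \<partial>m) = (\<integral>\<^sup>+y. emeasure m (ball y r \<inter> U) \<partial>\<mu>)"
proof -
  let ?f = "\<lambda>x y. indicator U x * indicator {p. dist (fst p) (snd p) < r} (x, y) :: ennreal"
  note [measurable] = near_pairs_measurable[of r]
  have "(\<lambda>p. indicator U (fst p) * indicator {p. dist (fst p) (snd p) < r} p :: ennreal)
    \<in> borel_measurable (m \<Otimes>\<^sub>M \<mu>)"
    by measurable
  then have meas: "case_prod ?f \<in> borel_measurable (m \<Otimes>\<^sub>M \<mu>)" by (simp add: case_prod_beta')
  have 1: "(\<integral>\<^sup>+y. ?f x y \<partial>\<mu>) = indicator U x * emeasure \<mu> (ball x r)" for x
  proof -
    have "(\<integral>\<^sup>+y. ?f x y \<partial>\<mu>) = (\<integral>\<^sup>+y. indicator U x * indicator (ball x r) y \<partial>\<mu>)"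
      by (intro nn_integral_cong) (auto simp: indicator_def)
    then show ?thesis by (simp add: nn_integral_cmult_indicator sets_mu)
  qed
  have 2: "(\<integral>\<^sup>+x. ?f x y \<partial>m) = emeasure m (ball y r \<inter> U)" for y
  proof -
    have "(\<integral>\<^sup>+x. ?f x y \<partial>m) = (\<integral>\<^sup>+x. indicator (ball y r \<inter> U) x \<partial>m)"
      by (intro nn_integral_cong) (auto simp: indicator_def dist_commute)
    then show ?thesis by (simp add: sets_m)
  qed
  from Fubini'[OF meas] show ?thesis unfolding 1 2 by simp
qed

definition rad :: "nat \<Rightarrow> real" where
  "rad k = \<rho> / 2 ^ k"

lemma rad_pos: "rad k > 0"
  using rho_pos by (simp add: rad_def)

lemma rad_Suc: "rad k = 2 * rad (Suc k)"
  by (simp add: rad_def)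

lemma rad_decseq: "decseq rad"
proof (rule decseq_SucI)
  show "rad (Suc k) \<le> rad k" for k using rad_pos[of "Suc k"] rad_Suc[of k] by simp
qed

lemma rad_le: "rad k \<le> \<rho>"
  using decseqD[OF rad_decseq, of 0 k] by (simp add: rad_def)

lemma rad_tendsto: "rad \<longlonglongrightarrow> 0"
proof -
  have "(\<lambda>k. \<rho> * (1/2) ^ k) \<longlonglongrightarrow> \<rho> * 0"
    by (intro tendsto_mult tendsto_const LIMSEQ_power_zero) simp
  moreover have "rad = (\<lambda>k. \<rho> * (1/2) ^ k)"
    by (rule ext) (simp add: rad_def power_one_over)
  ultimately show ?thesis by simp
qed

definition density_at :: "nat \<Rightarrow> 'a \<Rightarrow> ennreal" where
  "density_at k x = ennreal (1 / rad k powr d) * emeasure \<mu> (ball x (rad k))"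

text \<open>
  By monotonicity of \<open>density_at\<close> in the scale this supremum is a limit: up to the constant \<open>C\<close> it plays the
  role of the Radon--Nikodym derivative of \<open>\<mu>\<close> with respect to \<open>m\<close>.
\<close>

definition upper_density :: "'a \<Rightarrow> ennreal" where
  "upper_density x = (SUP k. density_at k x)"

lemma density_at_measurable [measurable]: "density_at k \<in> borel_measurable borel"
  unfolding density_at_def by measurable

lemma upper_density_measurable [measurable]: "upper_density \<in> borel_measurable borel"
  unfolding upper_density_def by measurable

lemma density_at_le_upper: "density_at k x \<le> upper_density x"
  unfolding upper_density_def by (intro SUP_upper) simp

text \<open>
  Halving the radius divides \<open>r\<^sup>d\<close> by \<open>2\<^sup>d\<close>, whereas \<open>\<mu>\<close> of the ball drops by at most that factor.
\<close>

lemma density_at_Suc: "density_at k x \<le> density_at (Suc k) x"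
proof -
  have "rad k powr d = 2 powr d * rad (Suc k) powr d"
    using rad_pos[of "Suc k"] by (simp add: rad_Suc[of k] powr_mult)
  then have "1 / rad k powr d * 2 powr d = 1 / rad (Suc k) powr d" by simp
  then have e: "ennreal (1 / rad k powr d) * ennreal (2 powr d) = ennreal (1 / rad (Suc k) powr d)"
    by (simp flip: ennreal_mult)
  have "density_at k x \<le> ennreal (1 / rad k powr d) * (ennreal (2 powr d) * emeasure \<mu> (ball x (rad (Suc k))))"
    unfolding density_at_def rad_Suc[of k, THEN arg_cong, of "ball x"]
    by (intro mult_left_mono mu_doubling rad_pos) simp
  also have "\<dots> = density_at (Suc k) x"
    unfolding density_at_def e[symmetric] by (simp add: mult.assoc)
  finally show ?thesis .
qed

lemma incseq_density_at: "incseq density_at"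
  by (intro incseq_SucI le_funI density_at_Suc)

lemma integral_density_at:
  assumes "U \<in> sets borel"
  shows "(\<integral>\<^sup>+x. indicator U x * density_at k x \<partial>m) =
    ennreal (1 / rad k powr d) * (\<integral>\<^sup>+y. emeasure m (ball y (rad k) \<inter> U) \<partial>\<mu>)"
proof -
  have [measurable]: "U \<in> sets borel" by (rule assms)
  have "(\<integral>\<^sup>+x. indicator U x * density_at k x \<partial>m) =
      (\<integral>\<^sup>+x. ennreal (1 / rad k powr d) * (indicator U x * emeasure \<mu> (ball x (rad k))) \<partial>m)"
    unfolding density_at_def by (simp only: mult.left_commute)
  also have "\<dots> = ennreal (1 / rad k powr d) * (\<integral>\<^sup>+x. indicator U x * emeasure \<mu> (ball x (rad k)) \<partial>m)"
    by (rule nn_integral_cmult) measurable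
  also have "(\<integral>\<^sup>+x. indicator U x * emeasure \<mu> (ball x (rad k)) \<partial>m) =
      (\<integral>\<^sup>+y. emeasure m (ball y (rad k) \<inter> U) \<partial>\<mu>)"
    by (rule integral_emeasure_ball[OF assms])
  finally show ?thesis .
qed

text \<open>
  After Fubini, \<open>y\<close> contributes only if its ball meets \<open>V\<close>, and then at most \<open>m(B(y,r\<^sub>k)) \<le> C r\<^sub>k\<^sup>d\<close>.
\<close>

lemma integral_density_at_le:
  assumes [measurable]: "V \<in> sets borel"
  shows "(\<integral>\<^sup>+x. indicator V x * density_at k x \<partial>m) \<le> ennreal C * emeasure \<mu> (thickening V (rad k))"
proof -
  have "emeasure m (ball y (rad k) \<inter> V) \<le> ennreal (C * rad k powr d) * indicator (thickening V (rad k)) y" for y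
  proof (cases "y \<in> thickening V (rad k)")
    case True
    have "emeasure m (ball y (rad k) \<inter> V) \<le> emeasure m (ball y (rad k))"
      by (intro emeasure_mono) (auto simp: sets_m)
    with m_upper[OF rad_pos rad_le] True show ?thesis by (auto intro: order_trans)
  next
    case False
    then have "ball y (rad k) \<inter> V = {}" by (auto simp: thickening_def dist_commute)
    then show ?thesis by simp
  qed
  then have "(\<integral>\<^sup>+y. emeasure m (ball y (rad k) \<inter> V) \<partial>\<mu>) \<le>
      (\<integral>\<^sup>+y. ennreal (C * rad k powr d) * indicator (thickening V (rad k)) y \<partial>\<mu>)"
    by (intro nn_integral_mono) auto
  also have "\<dots> = ennreal (C * rad k powr d) * emeasure \<mu> (thickening V (rad k))"
    by (intro nn_integral_cmult_indicator) (simp add: sets_mu)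
  finally have "(\<integral>\<^sup>+x. indicator V x * density_at k x \<partial>m) \<le>
      ennreal (1 / rad k powr d) * (ennreal (C * rad k powr d) * emeasure \<mu> (thickening V (rad k)))"
    unfolding integral_density_at[OF assms] by (intro mult_left_mono) auto
  also have "\<dots> = ennreal C * emeasure \<mu> (thickening V (rad k))"
    unfolding mult.assoc[symmetric] using rad_pos[of k] C_pos
    by (subst ennreal_mult[symmetric]) auto
  finally show ?thesis .
qed

text \<open>
  The set on the left consists of the \<open>y\<close> whose \<open>r\<^sub>k\<close>-ball lies in \<open>U\<close>; after Fubini each of them contributes
  the full \<open>m(B(y,r\<^sub>k)) \<ge> r\<^sub>k\<^sup>d / C\<close>.
\<close>

lemma emeasure_le_integral_density_at:
  assumes [measurable]: "U \<in> sets borel"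
  shows "emeasure \<mu> (- thickening (- U) (rad k)) \<le> ennreal C * (\<integral>\<^sup>+x. indicator U x * density_at k x \<partial>m)"
proof -
  let ?I = "- thickening (- U) (rad k)"
  have "ennreal (1 / C * rad k powr d) * indicator ?I y \<le> emeasure m (ball y (rad k) \<inter> U)" for y
  proof (cases "y \<in> ?I")
    case True
    then have "ball y (rad k) \<inter> U = ball y (rad k)"
      using not_in_thickening_Compl_iff by blast
    with m_lower[OF rad_pos rad_le] True show ?thesis by auto
  qed auto
  then have "(\<integral>\<^sup>+y. ennreal (1 / C * rad k powr d) * indicator ?I y \<partial>\<mu>) \<le> (\<integral>\<^sup>+y. emeasure m (ball y (rad k) \<inter> U) \<partial>\<mu>)"
    by (intro nn_integral_mono) auto
  also have "(\<integral>\<^sup>+y. ennreal (1 / C * rad k powr d) * indicator ?I y \<partial>\<mu>) = ennreal (1 / C * rad k powr d) * emeasure \<mu> ?I"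
    by (intro nn_integral_cmult_indicator) (simp add: sets_mu)
  finally have *: "ennreal (1 / C * rad k powr d) * emeasure \<mu> ?I \<le> (\<integral>\<^sup>+y. emeasure m (ball y (rad k) \<inter> U) \<partial>\<mu>)" .
  have "emeasure \<mu> ?I = ennreal C * (ennreal (1 / rad k powr d) * (ennreal (1 / C * rad k powr d) * emeasure \<mu> ?I))"
    unfolding mult.assoc[symmetric] using rad_pos[of k] C_pos
    by (simp add: ennreal_mult[symmetric])
  also have "\<dots> \<le> ennreal C * (\<integral>\<^sup>+x. indicator U x * density_at k x \<partial>m)"
    unfolding integral_density_at[OF assms] by (intro mult_left_mono *) auto
  finally show ?thesis .
qed

section \<open>Mutual absolute continuity\<close>

text \<open>
  Every point of an open set has a small ball inside it, so the sets on the left of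
  \<open>emeasure_le_integral_density_at\<close> exhaust \<open>U\<close> as \<open>k\<close> grows.
\<close>

lemma emeasure_open_le:
  assumes "open U"
  shows "emeasure \<mu> U \<le> ennreal C * (\<integral>\<^sup>+x. indicator U x * upper_density x \<partial>m)"
proof -
  let ?I = "\<lambda>k. - thickening (- U) (rad k)"
  have "(\<Union>k. ?I k) = - (\<Inter>k. thickening (- U) (rad k))" by auto
  also have "\<dots> = U"
    using Inter_thickening_closed[OF _ rad_tendsto rad_pos, of "- U"] assms by auto
  finally have "emeasure \<mu> U = emeasure \<mu> (\<Union>k. ?I k)" by simp
  also have "\<dots> = (SUP k. emeasure \<mu> (?I k))"
  proof (rule SUP_emeasure_incseq[symmetric])
    show "range ?I \<subseteq> sets \<mu>" by (auto simp: sets_mu)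
    show "incseq ?I"
      unfolding incseq_def
      by (intro allI impI Compl_anti_mono thickening_mono decseqD[OF rad_decseq])
  qed
  also have "\<dots> \<le> ennreal C * (\<integral>\<^sup>+x. indicator U x * upper_density x \<partial>m)"
  proof (rule SUP_least)
    fix k
    have "emeasure \<mu> (?I k) \<le> ennreal C * (\<integral>\<^sup>+x. indicator U x * density_at k x \<partial>m)"
      using assms by (intro emeasure_le_integral_density_at) auto
    also have "\<dots> \<le> ennreal C * (\<integral>\<^sup>+x. indicator U x * upper_density x \<partial>m)"
      by (intro mult_left_mono nn_integral_mono density_at_le_upper) auto
    finally show "emeasure \<mu> (?I k) \<le> ennreal C * (\<integral>\<^sup>+x. indicator U x * upper_density x \<partial>m)" .
  qed
  finally show ?thesis .
qed

text \<open>
  The integrals of the increasing functions \<open>density_at k\<close> over \<open>B(z,\<rho>)\<close> stay below a fixed multiple of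
  \<open>\<mu>(B(z,2\<rho>))\<close>. This is where a part of \<open>\<mu>\<close> that is singular to \<open>m\<close> is excluded: without monotonicity in \<open>k\<close>,
  bounded integrals would not prevent the mass from concentrating on an \<open>m\<close>-null set.
\<close>

lemma upper_density_integrable:
  "(\<integral>\<^sup>+x. indicator (ball z \<rho>) x * upper_density x \<partial>m) < \<infinity>"
proof -
  have "(\<integral>\<^sup>+x. indicator (ball z \<rho>) x * upper_density x \<partial>m) =
      (\<integral>\<^sup>+x. (SUP k. indicator (ball z \<rho>) x * density_at k x) \<partial>m)"
    by (simp add: upper_density_def SUP_mult_left_ennreal)
  also have "\<dots> = (SUP k. \<integral>\<^sup>+x. indicator (ball z \<rho>) x * density_at k x \<partial>m)"
    by (rule nn_integral_monotone_convergence_SUP)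
      (auto intro!: incseq_SucI le_funI mult_left_mono density_at_Suc)
  also have "\<dots> \<le> ennreal C * emeasure \<mu> (ball z (2 * \<rho>))"
  proof (rule SUP_least)
    fix k
    have "thickening (ball z \<rho>) (rad k) \<subseteq> ball z (2 * \<rho>)"
      by (intro thickening_ball_subset) (use rad_le[of k] in simp)
    then have "emeasure \<mu> (thickening (ball z \<rho>) (rad k)) \<le> emeasure \<mu> (ball z (2 * \<rho>))"
      by (intro emeasure_mono) (auto simp: sets_mu)
    then show "(\<integral>\<^sup>+x. indicator (ball z \<rho>) x * density_at k x \<partial>m) \<le> ennreal C * emeasure \<mu> (ball z (2 * \<rho>))"
      by (intro order_trans[OF integral_density_at_le] mult_left_mono) auto
  qed
  also have "\<dots> < \<infinity>" using mu_finite by (simp add: ennreal_mult_less_top)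
  finally show ?thesis .
qed

lemma null_set_locally:
  fixes M :: "'a measure"
  assumes [simp]: "sets M = sets borel" and "E \<in> sets borel"
    and "\<And>z. emeasure M (E \<inter> ball z \<rho>) = 0"
  shows "E \<in> null_sets M"
proof -
  have "(\<Union>z\<in>dense_set. E \<inter> ball z \<rho>) \<in> null_sets M"
    using assms by (intro null_sets_UN' countable_dense_set null_setsI) auto
  also have "(\<Union>z\<in>dense_set. E \<inter> ball z \<rho>) = E"
    using dense_set[OF rho_pos] by auto
  finally show ?thesis .
qed

text \<open>
  Regularity is applied on a ball to the finite measure with density \<open>upper_density\<close> with respect to \<open>m\<close>: it
  vanishes on \<open>E\<close>, so \<open>E\<close> has open supersets of small measure, and \<open>emeasure_open_le\<close> transfers the smallness to \<open>\<mu>\<close>.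
\<close>

lemma mu_absolutely_continuous: "absolutely_continuous m \<mu>"
  unfolding absolutely_continuous_def
proof
  fix E assume E: "E \<in> null_sets m"
  then have [measurable]: "E \<in> sets borel" by (auto simp: null_sets_def sets_m)
  show "E \<in> null_sets \<mu>"
  proof (rule null_set_locally[OF sets_mu])
    fix z :: 'a
    let ?V = "ball z \<rho>"
    let ?g = "\<lambda>x. indicator ?V x * upper_density x"
    let ?N = "density m ?g"
    have N: "emeasure ?N A = (\<integral>\<^sup>+x. indicator (A \<inter> ?V) x * upper_density x \<partial>m)" if "A \<in> sets borel" for A
    proof -
      have "?g \<in> borel_measurable m" by measurable
      then have "emeasure ?N A = (\<integral>\<^sup>+x. ?g x * indicator A x \<partial>m)"
        using that by (intro emeasure_density) (auto simp: sets_m)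
      then show ?thesis
        by (simp add: indicator_inter_arith mult.commute mult.left_commute)
    qed
    have "emeasure ?N UNIV < \<infinity>" using N[of UNIV] upper_density_integrable[of z] by simp
    then have fin: "finite_measure ?N" by (intro finite_measureI) auto
    then interpret N: finite_measure ?N .
    have EN: "E \<in> null_sets ?N"
      using E absolutely_continuousI_density[of ?g m]
      by (auto simp: absolutely_continuous_def)
    have "emeasure \<mu> (E \<inter> ?V) \<le> ennreal C * ennreal e" if "e > 0" for e :: real
    proof -
      obtain F U where U: "closed F" "open U" "F \<subseteq> E" "E \<subseteq> U" "measure ?N (U - F) < e"
        using finite_borel_measure_regular[OF fin _ \<open>E \<in> sets borel\<close> \<open>e > 0\<close>] by (auto simp: sets_m)
      have FN: "F \<in> null_sets ?N"
        using EN U by (intro null_sets_subset[OF EN]) (auto simp: sets_m)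
      have "emeasure \<mu> (E \<inter> ?V) \<le> emeasure \<mu> (U \<inter> ?V)"
        using U by (intro emeasure_mono) (auto simp: sets_mu)
      also have "\<dots> \<le> ennreal C * emeasure ?N U"
        using emeasure_open_le[of "U \<inter> ?V"] U N[of U] by auto
      also have "emeasure ?N U = emeasure ?N (U - F)"
        using U by (intro emeasure_Diff_null_set[symmetric] FN) (auto simp: sets_m)
      also have "\<dots> \<le> ennreal e"
        unfolding N.emeasure_eq_measure using U(5) by (intro ennreal_leI less_imp_le)
      finally show ?thesis by (simp add: mult_left_mono)
    qed
    from this[of "e / C" for e] have "emeasure \<mu> (E \<inter> ?V) \<le> 0 + ennreal e" if "e > 0" for e
      using that C_pos by (simp add: ennreal_mult[symmetric])
    then have "emeasure \<mu> (E \<inter> ?V) \<le> 0" by (rule ennreal_le_epsilon)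
    then show "emeasure \<mu> (E \<inter> ?V) = 0" by simp
  qed simp
qed

text \<open>
  The upper bound \<open>integral_density_at_le\<close> loses a neighbourhood of the set. Neighbourhoods of a closed set shrink
  back to it, so closed subsets of \<open>E\<close> inside a ball are \<open>m\<close>-null, and \<open>E\<close> is then \<open>m\<close>-null by inner
  regularity.
\<close>

lemma m_absolutely_continuous: "absolutely_continuous \<mu> m"
  unfolding absolutely_continuous_def
proof
  fix E assume E: "E \<in> null_sets \<mu>"
  then have [measurable]: "E \<in> sets borel" by (auto simp: null_sets_def sets_mu)
  show "E \<in> null_sets m"
  proof (rule null_set_locally[OF sets_m])
    fix z :: 'a
    let ?V = "ball z \<rho>"
    let ?N = "density m (indicator ?V)"
    have N: "emeasure ?N A = emeasure m (A \<inter> ?V)" if "A \<in> sets borel" for A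
      using that by (subst emeasure_density) (auto simp: sets_m Int_commute simp flip: indicator_inter_arith)
    have "emeasure ?N UNIV < \<infinity>" using N[of UNIV] m_finite[of z] by simp
    then have fin: "finite_measure ?N" by (intro finite_measureI) auto
    then interpret N: finite_measure ?N .
    define c where "c = emeasure \<mu> ?V"
    have c_pos: "c > 0" unfolding c_def by (rule mu_pos[OF rho_pos])
    \<comment> \<open>Up to a constant, \<open>\<mu>(B(z,\<rho>))\<close> bounds every density from below at the points of \<open>B(z,\<rho>)\<close>, since
      \<open>B(z,\<rho>) \<subseteq> B(x,2\<rho>)\<close>.\<close>
    have c_le: "c \<le> ennreal ((2 * \<rho>) powr d) * density_at k x" if "x \<in> ?V" for x k
    proof -
      have "c \<le> emeasure \<mu> (ball x (2 * \<rho>))"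
        unfolding c_def
      proof (intro emeasure_mono subsetI)
        fix y assume "y \<in> ?V"
        with that dist_triangle3[of x y z] show "y \<in> ball x (2 * \<rho>)" by simp
      qed (simp add: sets_mu)
      also have "\<dots> \<le> ennreal (2 powr d) * emeasure \<mu> (ball x \<rho>)" by (rule mu_doubling[OF rho_pos])
      also have "\<dots> = ennreal ((2 * \<rho>) powr d) * density_at 0 x"
        unfolding density_at_def mult.assoc[symmetric] using rho_pos
        by (subst ennreal_mult[symmetric]) (auto simp: rad_def powr_mult)
      also have "\<dots> \<le> ennreal ((2 * \<rho>) powr d) * density_at k x"
        using incseqD[OF incseq_density_at, of 0 k] by (intro mult_left_mono) (auto simp: le_fun_def)
      finally show ?thesis .
    qed
    have closed_null: "emeasure m K = 0" if "closed K" "K \<subseteq> E \<inter> ?V" for K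
    proof -
      have bor [measurable]: "K \<in> sets borel" using that by simp
      let ?T = "\<lambda>k. thickening K (rad k)"
      let ?a = "ennreal ((2 * \<rho>) powr d)"
      have le: "c * emeasure m K \<le> ?a * ennreal C * emeasure \<mu> (?T k)" for k
      proof -
        have "c * emeasure m K = (\<integral>\<^sup>+x. c * indicator K x \<partial>m)"
          by (simp add: nn_integral_cmult_indicator sets_m)
        also have "\<dots> \<le> (\<integral>\<^sup>+x. ?a * (indicator K x * density_at k x) \<partial>m)"
          using that c_le[of _ k] by (intro nn_integral_mono) (auto simp: indicator_def)
        also have "\<dots> = ?a * (\<integral>\<^sup>+x. indicator K x * density_at k x \<partial>m)"
          by (intro nn_integral_cmult) measurable
        also have "\<dots> \<le> ?a * (ennreal C * emeasure \<mu> (?T k))"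
          by (intro mult_left_mono integral_density_at_le) auto
        finally show ?thesis by (simp add: mult.assoc)
      qed
      have T_fin: "emeasure \<mu> (?T k) \<noteq> \<infinity>" for k
      proof -
        have "?T k \<subseteq> ball z (2 * \<rho>)"
          by (intro order_trans[OF thickening_mono_set thickening_ball_subset[of \<rho> "rad k" _ z]])
            (use rad_le[of k] that in auto)
        then have "emeasure \<mu> (?T k) \<le> emeasure \<mu> (ball z (2 * \<rho>))"
          by (intro emeasure_mono) (auto simp: sets_mu)
        with mu_finite[of z "2 * \<rho>"] show ?thesis by (auto simp: top_unique)
      qed
      have "(\<lambda>k. emeasure \<mu> (?T k)) \<longlonglongrightarrow> emeasure \<mu> (\<Inter>k. ?T k)"
      proof (rule Lim_emeasure_decseq)
        show "decseq ?T"
          using rad_decseq by (auto simp: decseq_def intro!: thickening_mono)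
      qed (use T_fin in \<open>auto simp: sets_mu\<close>)
      also have "(\<Inter>k. ?T k) = K"
        using that by (intro Inter_thickening_closed rad_tendsto rad_pos)
      also have "emeasure \<mu> K = 0"
      proof -
        have "emeasure \<mu> K \<le> emeasure \<mu> E" using that by (intro emeasure_mono) (auto simp: sets_mu)
        then show ?thesis using E by (auto simp: null_sets_def)
      qed
      finally have "(\<lambda>k. ?a * ennreal C * emeasure \<mu> (?T k)) \<longlonglongrightarrow> ?a * ennreal C * 0"
        by (intro ennreal_tendsto_cmult) (auto simp: ennreal_mult_less_top)
      then have "c * emeasure m K \<le> ?a * ennreal C * 0"
        by (rule LIMSEQ_le_const) (use le in blast)
      with c_pos show ?thesis by auto
    qed
    have "emeasure m (E \<inter> ?V) \<le> 0 + ennreal e" if "e > 0" for e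
    proof -
      have EV: "E \<inter> ?V \<in> sets borel" by simp
      obtain F U where U: "closed F" "open U" "F \<subseteq> E \<inter> ?V" "E \<inter> ?V \<subseteq> U" "measure ?N (U - F) < e"
        using finite_borel_measure_regular[OF fin _ EV \<open>e > 0\<close>] by (auto simp: sets_m)
      have "emeasure m (E \<inter> ?V) \<le> emeasure m (F \<union> ((U - F) \<inter> ?V))"
        using U by (intro emeasure_mono) (auto simp: sets_m)
      also have "\<dots> \<le> emeasure m F + emeasure m ((U - F) \<inter> ?V)"
        using U by (intro emeasure_subadditive) (auto simp: sets_m)
      also have "emeasure m F = 0" using U by (intro closed_null)
      also have "emeasure m ((U - F) \<inter> ?V) = emeasure ?N (U - F)"
        using U by (intro N[symmetric]) auto
      also have "\<dots> \<le> ennreal e"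
        unfolding N.emeasure_eq_measure using U(5) by (intro ennreal_leI less_imp_le)
      finally show ?thesis by (simp add: add_left_mono)
    qed
    then have "emeasure m (E \<inter> ?V) \<le> 0" by (rule ennreal_le_epsilon)
    then show "emeasure m (E \<inter> ?V) = 0" by simp
  qed simp
qed

end

section \<open>Doubling measures and doubling minimizers\<close>

lemma doubling_measure_iterate:
  assumes "doubling_measure M"
  obtains C :: real where "C > 0"
    "\<And>x r n. r > 0 \<Longrightarrow> emeasure M (ball x (2 ^ n * r)) \<le> ennreal (C ^ n) * emeasure M (ball x r)"
proof -
  from assms obtain C :: real where C: "C > 0"
    and dbl: "\<And>x r. r > 0 \<Longrightarrow> emeasure M (ball x (2 * r)) \<le> ennreal C * emeasure M (ball x r)"
    unfolding doubling_measure_def by blast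
  have "emeasure M (ball x (2 ^ n * r)) \<le> ennreal (C ^ n) * emeasure M (ball x r)" if "r > 0" for x r n
  proof (induction n)
    case (Suc n)
    have "emeasure M (ball x (2 ^ Suc n * r)) \<le> ennreal C * emeasure M (ball x (2 ^ n * r))"
      using dbl[of "2 ^ n * r" x] that by (simp add: mult.assoc)
    also have "\<dots> \<le> ennreal C * (ennreal (C ^ n) * emeasure M (ball x r))"
      by (intro mult_left_mono Suc.IH) simp
    also have "\<dots> = ennreal (C ^ Suc n) * emeasure M (ball x r)"
      using C by (simp add: ennreal_mult mult.assoc)
    finally show ?case .
  qed simp
  with C show thesis by (rule that)
qed

lemma ball_subset_dyadic_ball:
  fixes x y :: "'a::metric_space"
  assumes "s > 0"
  obtains n where "ball x r \<subseteq> ball y (2 ^ n * s)"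
proof -
  obtain n where "(r + dist y x) / s < 2 ^ n" using real_arch_pow[of 2] by auto
  then have n: "r + dist y x < 2 ^ n * s" using assms by (simp add: field_simps)
  have "ball x r \<subseteq> ball y (2 ^ n * s)"
  proof
    fix w assume "w \<in> ball x r"
    with n dist_triangle[of y w x] show "w \<in> ball y (2 ^ n * s)" by simp
  qed
  then show thesis by (rule that)
qed

text \<open>
  One ball of positive finite measure suffices: any two balls are contained in dyadic enlargements of each
  other, and each enlargement costs only a finite factor.
\<close>

lemma doubling_measure_ball:
  fixes M :: "'a::metric_space measure"
  assumes "doubling_measure M"
  shows "r > 0 \<Longrightarrow> 0 < emeasure M (ball x r)" and "emeasure M (ball x r) < \<infinity>"
proof -
  obtain C :: real where C: "C > 0" and it:
    "\<And>x r n. r > 0 \<Longrightarrow> emeasure M (ball x (2 ^ n * r)) \<le> ennreal (C ^ n) * emeasure M (ball x r)"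
    using doubling_measure_iterate[OF assms] by blast
  from assms obtain x0 r0 where r0: "r0 > 0"
    and b0: "0 < emeasure M (ball x0 r0)" "emeasure M (ball x0 r0) < \<infinity>"
    unfolding doubling_measure_def by blast
  have balls: "ball y s \<in> sets M" for y s
    using assms unfolding doubling_measure_def borel_regular_measure_def by auto
  show "0 < emeasure M (ball x r)" if "r > 0"
  proof -
    obtain n where "ball x0 r0 \<subseteq> ball x (2 ^ n * r)"
      using ball_subset_dyadic_ball[OF \<open>r > 0\<close>] by blast
    then have "emeasure M (ball x0 r0) \<le> emeasure M (ball x (2 ^ n * r))"
      by (intro emeasure_mono balls)
    also have "\<dots> \<le> ennreal (C ^ n) * emeasure M (ball x r)" by (rule it[OF that])
    finally have "0 < ennreal (C ^ n) * emeasure M (ball x r)" using b0(1) by (rule less_le_trans[rotated])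
    then show ?thesis by (simp add: ennreal_zero_less_mult_iff)
  qed
  obtain n where "ball x r \<subseteq> ball x0 (2 ^ n * r0)"
    using ball_subset_dyadic_ball[OF r0] by blast
  then have "emeasure M (ball x r) \<le> emeasure M (ball x0 (2 ^ n * r0))"
    by (intro emeasure_mono balls)
  also have "\<dots> \<le> ennreal (C ^ n) * emeasure M (ball x0 r0)" by (rule it[OF r0])
  also have "\<dots> < \<infinity>" using b0(2) by (simp add: ennreal_mult_less_top)
  finally show "emeasure M (ball x r) < \<infinity>" .
qed

text \<open>
  The denominator can be cleared in the extended reals because balls have neither measure \<open>0\<close> nor \<open>\<infinity>\<close>.
\<close>

lemma doubling_constant_bound:
  fixes M :: "'a::metric_space measure"
  assumes "doubling_measure M" "r > 0"
  shows "emeasure M (ball x (2 * r)) \<le> doubling_constant M * emeasure M (ball x r)"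
proof -
  let ?a = "emeasure M (ball x (2 * r))" and ?b = "emeasure M (ball x r)"
  have b: "0 < ?b" "?b < \<infinity>" using doubling_measure_ball[OF assms(1)] assms(2) by auto
  have "?a / ?b \<le> doubling_constant M"
    unfolding doubling_constant_def using assms(2) by (intro SUP_upper2[of "(x, r)"]) auto
  then have "?a / ?b * ?b \<le> doubling_constant M * ?b" by (rule mult_right_mono) simp
  moreover have "?a / ?b * ?b = ?a"
    using b by (simp add: ennreal_divide_times ennreal_mult_divide_eq less_top)
  ultimately show ?thesis by simp
qed

theorem proposition1p7:
  fixes d :: real and m :: "'a::metric_space measure"
  assumes "d > 0"
    and "d_measure d m"
    and "least_doubling_constant TYPE('a) = ennreal (2 powr d)"
  shows "\<forall>\<mu> \<in> (doubling_minimizers :: 'a measure set). abs_cont \<mu> m \<and> abs_cont m \<mu>"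
proof
  fix \<mu> :: "'a measure" assume "\<mu> \<in> doubling_minimizers"
  then have dbl: "doubling_measure \<mu>" and const: "doubling_constant \<mu> = ennreal (2 powr d)"
    using assms(3) by (auto simp: doubling_minimizers_def)
  from dbl have borel_sub: "sets borel \<subseteq> sets \<mu>"
    and regular: "\<And>A. A \<in> sets \<mu> \<Longrightarrow> \<exists>B\<in>sets borel. A \<subseteq> B \<and> emeasure \<mu> B = emeasure \<mu> A"
    by (auto simp: doubling_measure_def borel_regular_measure_def)
  \<comment> \<open>The sets measured by \<open>\<mu>\<close> may go beyond the Borel sets; the comparison is made for the restriction of
    \<open>\<mu>\<close> to the Borel sets, and Borel regularity brings it back to \<open>\<mu>\<close>.\<close>
  define \<nu> where "\<nu> = distr \<mu> borel (\<lambda>x. x)"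
  have "space \<mu> = UNIV"
  proof -
    have "UNIV \<in> sets \<mu>" using borel_sub by (rule subsetD) simp
    from sets.sets_into_space[OF this] show ?thesis by auto
  qed
  then have id_meas: "(\<lambda>x. x) \<in> measurable \<mu> borel"
    using borel_sub by (auto intro!: measurableI)
  have nu: "emeasure \<nu> A = emeasure \<mu> A" if "A \<in> sets borel" for A
    unfolding \<nu>_def using that \<open>space \<mu> = UNIV\<close> by (simp add: emeasure_distr[OF id_meas])
  from assms(2) obtain C r0 :: real where C: "C \<ge> 1" "r0 > 0" and sets_m: "sets m = sets borel"
    and reg: "\<And>x r. 0 < r \<Longrightarrow> r \<le> r0 \<Longrightarrow> ennreal (1 / C * r powr d) \<le> emeasure m (ball x r)"
      "\<And>x r. 0 < r \<Longrightarrow> r \<le> r0 \<Longrightarrow> emeasure m (ball x r) \<le> ennreal (C * r powr d)"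
    unfolding d_measure_def by blast
  interpret critical_pair d C r0 m \<nu>
  proof
    show "emeasure \<nu> (ball x (2 * r)) \<le> ennreal (2 powr d) * emeasure \<nu> (ball x r)" if "0 < r" for x r
      using doubling_constant_bound[OF dbl that] by (simp add: nu const)
  qed (use C sets_m reg doubling_measure_ball[OF dbl] in \<open>simp_all add: nu, simp_all add: \<nu>_def\<close>)
  have "abs_cont \<mu> m"
    unfolding abs_cont_def absolutely_continuous_def
  proof
    fix A assume "A \<in> null_sets (completion m)"
    then obtain B where B: "B \<in> null_sets m" "A \<subseteq> B"
      unfolding null_sets_completion_iff2 by blast
    then have bor: "B \<in> sets borel" by (auto simp: null_sets_def sets_m)
    from B have "B \<in> null_sets \<nu>" using mu_absolutely_continuous by (auto simp: absolutely_continuous_def)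
    then have "B \<in> null_sets \<mu>" using bor borel_sub by (auto simp: null_sets_def nu)
    with B show "A \<in> null_sets (completion \<mu>)" unfolding null_sets_completion_iff2 by blast
  qed
  moreover have "abs_cont m \<mu>"
    unfolding abs_cont_def absolutely_continuous_def
  proof
    fix A assume "A \<in> null_sets (completion \<mu>)"
    then obtain N where N: "N \<in> null_sets \<mu>" "A \<subseteq> N"
      unfolding null_sets_completion_iff2 by blast
    then obtain B where B: "B \<in> sets borel" "N \<subseteq> B" "emeasure \<mu> B = 0"
      using regular[of N] by (auto simp: null_sets_def)
    then have "B \<in> null_sets \<nu>" by (intro null_setsI) (simp_all add: nu sets_mu)
    then have "B \<in> null_sets m" using m_absolutely_continuous by (auto simp: absolutely_continuous_def)
    with B N show "A \<in> null_sets (completion m)" unfolding null_sets_completion_iff2 by blast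
  qed
  ultimately show "abs_cont \<mu> m \<and> abs_cont m \<mu>" ..
qed

end
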